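(* Let $p\ge1$ and $d\ge1$ be integers, let $K=K_{\mathbf x}\times K_t\subset\mathbb R^{d}\times\mathbb R$ be a space--time element, where $K_{\mathbf x}\subset\mathbb R^d$ is a $d$-dimensional polytope and $K_t\subset\mathbb R$ is a bounded time interval, and let $t_K\in K_t$ be fixed. Let $r_{d,2p}=\binom{2p+d}{d}$ and let $\{m_J\}_{J=1}^{r_{d,2p}}$ be a basis of the space $\mathbb P^{2p}(K_{\mathbf x})$ of complex polynomials of total degree at most $2p$ in the $d$ variables $\mathbf x$. Then the set $$\mathcal B_{2p}^{\mathbf T}:=\Big\{b_J^{\mathbf T}\in\mathbb P^{2p}_{\mathbf T}(K):\ b_J^{\mathbf T}(\mathbf x,t_K)=m_J(\mathbf x)\ \ \forall \mathbf x\in K_{\mathbf x},\quad J=1,\dots,r_{d,2p}\Big\}$$ (consisting of one function $b_J^{\mathbf T}$ for each $J=1,\dots,r_{d,2p}$) constitutes a basis of the space $\mathbb P^{2p}_{\mathbf T}(K)$.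
   Context: $\mathbb P^{2p}_{\mathbf T}(K)$ is the space of Trefftz polynomials: complex-valued polynomials $q(\mathbf x,t)$ on $K$ of total degree at most $2p$ in the $d+1$ variables $(\mathbf x,t)$ that satisfy the Schrödinger equation $i\,\partial_t q+\frac12\Delta_{\mathbf x}q=0$ in $K$, where $\Delta_{\mathbf x}$ is the Laplacian in the space variables. The number $r_{d,2p}=\binom{2p+d}{d}$ is the dimension of the space of polynomials of degree at most $2p$ in $d$ variables. *)

theory Defs
  imports "HOL-Analysis.Analysis" "HOL-Library.Function_Algebras"
begin

definition fscale :: "complex \<Rightarrow> ('a \<Rightarrow> complex) \<Rightarrow> 'a \<Rightarrow> complex" where
  "fscale c f = (\<lambda>x. c * f x)"

interpretation cfun: vector_space "fscale :: complex \<Rightarrow> ('a \<Rightarrow> complex) \<Rightarrow> 'a \<Rightarrow> complex"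
  by unfold_locales (auto simp: fscale_def fun_eq_iff algebra_simps)

definition basis_of :: "('a \<Rightarrow> complex) set \<Rightarrow> ('a \<Rightarrow> complex) set \<Rightarrow> bool" where
  "basis_of B V \<longleftrightarrow> B \<subseteq> V \<and> cfun.independent B \<and> cfun.span B = V"

text \<open>
  Polynomials on a Euclidean space, in the coordinates given by its standard basis. Only the
  values of the exponent \<open>\<alpha>\<close> on \<^term>\<open>Basis\<close> matter. For \<^typ>\<open>(real ^ 'd) \<times> real\<close> the
  variables are the space coordinates and time.
\<close>

definition monomial :: "('a::euclidean_space \<Rightarrow> nat) \<Rightarrow> 'a \<Rightarrow> complex" where
  "monomial \<alpha> x = (\<Prod>b\<in>Basis. complex_of_real (x \<bullet> b) ^ \<alpha> b)"

definition polys :: "nat \<Rightarrow> ('a::euclidean_space \<Rightarrow> complex) set" where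
  "polys k = cfun.span {monomial \<alpha> | \<alpha>. (\<Sum>b\<in>Basis. \<alpha> b) \<le> k}"

text \<open>
  A function on a set \<open>S\<close> is represented by its extension by zero, so that two functions on \<open>S\<close>
  coincide iff their representatives are equal.
\<close>

definition on_set :: "'a set \<Rightarrow> ('a \<Rightarrow> complex) \<Rightarrow> 'a \<Rightarrow> complex" where
  "on_set S f = (\<lambda>x. if x \<in> S then f x else 0)"

definition poly_space :: "nat \<Rightarrow> 'a::euclidean_space set \<Rightarrow> ('a \<Rightarrow> complex) set" where
  "poly_space k S = on_set S ` polys k"

definition partial_deriv :: "'a::euclidean_space \<Rightarrow> ('a \<Rightarrow> complex) \<Rightarrow> 'a \<Rightarrow> complex" where
  "partial_deriv b f x = vector_derivative (\<lambda>s. f (x + s *\<^sub>R b)) (at 0)"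

definition laplacian :: "('a::euclidean_space \<Rightarrow> complex) \<Rightarrow> 'a \<Rightarrow> complex" where
  "laplacian f x = (\<Sum>b\<in>Basis. partial_deriv b (partial_deriv b f) x)"

definition schroedinger :: "('a::euclidean_space \<times> real \<Rightarrow> complex) \<Rightarrow> 'a \<Rightarrow> real \<Rightarrow> complex" where
  "schroedinger q x t =
     \<i> * vector_derivative (\<lambda>s. q (x, s)) (at t) + 1 / 2 * laplacian (\<lambda>y. q (y, t)) x"

text \<open>
  The derivatives in the equation are those of the polynomial itself, so they also make sense at
  boundary points of \<open>K\<close>; when \<open>K\<close> has nonempty interior, a function on \<open>K\<close> comes from at most
  one polynomial.
\<close>

definition trefftz_space ::
  "nat \<Rightarrow> ('a::euclidean_space \<times> real) set \<Rightarrow> ('a \<times> real \<Rightarrow> complex) set" where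
  "trefftz_space k K =
     on_set K ` {q \<in> polys k. \<forall>(x, t) \<in> K. schroedinger q x t = 0}"

end

(*
A polynomial q is a finite sum of powers of t - tK with coefficients c_j polynomial in x, and q
solves the equation iff i (j + 1) c_(j+1) + (1/2) Laplacian c_j = 0 for all j. So c_0 = q(., tK)
determines q and may be any polynomial of degree at most 2p: restriction to t = tK is a linear
bijection from the Trefftz space onto the polynomials on Kx, and pulls bases back to bases.
*)

theory Submission
  imports Defs
begin

section \<open>Polynomials\<close>

lemma polys_induct [consumes 1, case_names zero step]:
  assumes "f \<in> polys k"
    and "P (\<lambda>_. 0)"
    and "\<And>c \<alpha> g. (\<Sum>b\<in>Basis. \<alpha> b) \<le> k \<Longrightarrow> g \<in> polys k \<Longrightarrow> P g \<Longrightarrow>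
      P (\<lambda>x. c * monomial \<alpha> x + g x)"
  shows "P f"
proof -
  have "f \<in> polys k \<and> P f"
    using assms(1) unfolding polys_def
  proof (induction rule: cfun.span_induct_alt)
    case base
    show ?case
      using assms(2) cfun.span_zero by (auto simp: zero_fun_def)
  next
    case (step c x y)
    then obtain \<alpha> where \<alpha>: "x = monomial \<alpha>" "(\<Sum>b\<in>Basis. \<alpha> b) \<le> k"
      by auto
    have "P (\<lambda>z. c * monomial \<alpha> z + y z)"
      using step \<alpha> by (intro assms(3)) (auto simp: polys_def)
    moreover have "(\<lambda>z. c * monomial \<alpha> z + y z) = fscale c x + y"
      by (auto simp: fscale_def \<alpha>)
    ultimately have "P (fscale c x + y)" by simp
    with step show ?case
      by (blast intro: cfun.span_add cfun.span_scale cfun.span_base)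
  qed
  then show ?thesis by simp
qed

lemma polys_zero: "(\<lambda>_. 0) \<in> polys k"
  using cfun.span_zero unfolding polys_def zero_fun_def by auto

lemma polys_add: "f \<in> polys k \<Longrightarrow> g \<in> polys k \<Longrightarrow> (\<lambda>x. f x + g x) \<in> polys k"
  using cfun.span_add unfolding polys_def plus_fun_def by auto

lemma polys_cmult: "f \<in> polys k \<Longrightarrow> (\<lambda>x. c * f x) \<in> polys k"
  using cfun.span_scale unfolding polys_def fscale_def by auto

lemma polys_sum:
  "(\<And>i. i \<in> I \<Longrightarrow> f i \<in> polys k) \<Longrightarrow> (\<lambda>x. \<Sum>i\<in>I. f i x) \<in> polys k"
  by (induction I rule: infinite_finite_induct) (auto simp: polys_zero polys_add)

lemma polys_mono: "k \<le> l \<Longrightarrow> f \<in> polys k \<Longrightarrow> f \<in> polys l"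
  using cfun.span_mono[of "{monomial \<alpha> | \<alpha>. (\<Sum>b\<in>Basis. \<alpha> b) \<le> k}"
      "{monomial \<alpha> | \<alpha>. (\<Sum>b\<in>Basis. \<alpha> b) \<le> l}"]
  unfolding polys_def by fastforce

lemma monomial_in_polys: "(\<Sum>b\<in>Basis. \<alpha> b) \<le> k \<Longrightarrow> monomial \<alpha> \<in> polys k"
  unfolding polys_def by (auto intro!: cfun.span_base)

lemma monomial_zero: "monomial (\<lambda>_. 0) x = 1"
  by (simp add: monomial_def)

lemma polys_const: "(\<lambda>_. c) \<in> polys k"
proof -
  have "(\<lambda>x. c * monomial (\<lambda>_. 0) x) \<in> polys k"
    by (intro polys_cmult monomial_in_polys) simp
  then show ?thesis by (simp add: monomial_zero)
qed

text \<open>Inducting on both factors in turn reduces the claim to two monomials, whose exponents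
  add.\<close>

lemma polys_mult:
  assumes f: "f \<in> polys k" and g: "g \<in> polys l"
  shows "(\<lambda>x. f x * g x) \<in> polys (k + l)"
  using f
proof (induction rule: polys_induct)
  case zero
  show ?case by (simp add: polys_zero)
next
  case (step c \<alpha> f)
  have "(\<lambda>x. monomial \<alpha> x * g x) \<in> polys (k + l)"
    using g
  proof (induction rule: polys_induct)
    case zero
    show ?case by (simp add: polys_zero)
  next
    case (step d \<beta> g)
    have "monomial (\<lambda>b. \<alpha> b + \<beta> b) \<in> polys (k + l)"
      using step.hyps \<open>sum \<alpha> Basis \<le> k\<close> by (intro monomial_in_polys) (auto simp: sum.distrib)
    then have "(\<lambda>x. d * monomial (\<lambda>b. \<alpha> b + \<beta> b) x + monomial \<alpha> x * g x) \<in> polys (k + l)"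
      by (intro polys_add polys_cmult step)
    then show ?case
      by (simp add: monomial_def power_add prod.distrib algebra_simps)
  qed
  then have "(\<lambda>x. c * (monomial \<alpha> x * g x) + f x * g x) \<in> polys (k + l)"
    by (intro polys_add polys_cmult step)
  then show ?case by (simp add: algebra_simps)
qed

lemma polys_power: "f \<in> polys 1 \<Longrightarrow> (\<lambda>x. f x ^ n) \<in> polys n"
proof (induction n)
  case 0
  then show ?case by (simp add: polys_const)
next
  case (Suc n)
  then show ?case using polys_mult[of f 1 "\<lambda>x. f x ^ n" n] by simp
qed

text \<open>This is what makes the series of iterated Laplacians terminate: after \<open>p\<close>
  Laplacians, degree \<open>2 * p\<close> has dropped to \<open>0\<close>.\<close>

lemma polys_0_constant:
  assumes "f \<in> polys 0"
  obtains c where "f = (\<lambda>_. c)"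
proof -
  have "\<exists>c. f = (\<lambda>_. c)"
    using assms
  proof (induction rule: polys_induct)
    case zero
    show ?case by auto
  next
    case (step c \<alpha> g)
    then show ?case by (auto simp: monomial_def)
  qed
  then show ?thesis using that by auto
qed

lemma polys_continuous: "f \<in> polys k \<Longrightarrow> continuous_on S f"
proof (induction rule: polys_induct)
  case (step c \<alpha> g)
  then show ?case
    unfolding monomial_def by (intro continuous_intros)
qed auto


section \<open>Derivatives of polynomials\<close>

text \<open>Along the direction \<open>b\<close> only the factor of that coordinate varies. If
  \<open>\<alpha> b = 0\<close>, the truncated exponent is harmless because the factor
  \<open>of_nat (\<alpha> b)\<close> vanishes.\<close>

lemma monomial_has_partial_deriv:
  assumes b: "b \<in> Basis"
  shows "((\<lambda>s. monomial \<alpha> (x + s *\<^sub>R b)) has_vector_derivative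
    of_nat (\<alpha> b) * monomial (\<alpha>(b := \<alpha> b - 1)) x) (at 0)"
proof -
  let ?R = "\<Prod>c\<in>Basis - {b}. complex_of_real (x \<bullet> c) ^ \<alpha> c"
  have split: "monomial \<beta> y = complex_of_real (y \<bullet> b) ^ \<beta> b *
      (\<Prod>c\<in>Basis - {b}. complex_of_real (y \<bullet> c) ^ \<beta> c)" for \<beta> y
    unfolding monomial_def by (rule prod.remove) (use b in auto)
  have "(\<Prod>c\<in>Basis - {b}. complex_of_real ((x + s *\<^sub>R b) \<bullet> c) ^ \<alpha> c) = ?R" for s
    using b by (intro prod.cong) (auto simp: inner_add_left inner_not_same_Basis)
  then have eq: "monomial \<alpha> (x + s *\<^sub>R b) = (of_real (x \<bullet> b) + of_real s) ^ \<alpha> b * ?R" for s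
    unfolding split[of \<alpha>] using b by (simp add: inner_add_left)
  \<comment> \<open>The derivative is taken in a complex variable \<open>z\<close>, where the power
    rule applies, and then restricted to real \<open>s\<close>.\<close>
  have "((\<lambda>z. (of_real (x \<bullet> b) + z) ^ \<alpha> b * ?R) has_field_derivative
      of_nat (\<alpha> b) * of_real (x \<bullet> b) ^ (\<alpha> b - 1) * ?R) (at (of_real 0))"
    by (auto intro!: derivative_eq_intros)
  then have "((\<lambda>s. (of_real (x \<bullet> b) + of_real s) ^ \<alpha> b * ?R) has_vector_derivative
      of_nat (\<alpha> b) * of_real (x \<bullet> b) ^ (\<alpha> b - 1) * ?R) (at 0)"
    by (rule has_vector_derivative_real_field)
  moreover have "monomial (\<alpha>(b := \<alpha> b - 1)) x = of_real (x \<bullet> b) ^ (\<alpha> b - 1) * ?R"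
    unfolding split by (auto intro!: prod.cong)
  ultimately show ?thesis
    by (simp add: eq mult.assoc)
qed

text \<open>Since \<open>partial_deriv\<close> is meaningful only where the derivative exists, the
  induction produces the derivative and its degree bound together; only afterwards is it identified
  with \<open>partial_deriv\<close>.\<close>

lemma polys_has_partial_deriv_in_polys:
  assumes b: "b \<in> Basis" and f: "f \<in> polys k"
  shows "\<exists>g\<in>polys (k - 1). \<forall>x. ((\<lambda>s. f (x + s *\<^sub>R b)) has_vector_derivative g x) (at 0)"
  using f
proof (induction rule: polys_induct)
  case zero
  show ?case by (intro bexI[of _ "\<lambda>_. 0"]) (auto simp: polys_zero)
next
  case (step c \<alpha> f)
  then obtain g where g: "g \<in> polys (k - 1)"
    "\<And>x. ((\<lambda>s. f (x + s *\<^sub>R b)) has_vector_derivative g x) (at 0)" by blast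
  let ?h = "\<lambda>x. of_nat (\<alpha> b) * monomial (\<alpha>(b := \<alpha> b - 1)) x"
  have "?h \<in> polys (k - 1)"
  \<comment> \<open>For \<open>\<alpha> b = 0\<close> the exponent would not get smaller, but then
    \<open>?h\<close> is zero.\<close>
  proof (cases "\<alpha> b = 0")
    case True
    then show ?thesis by (simp add: polys_zero)
  next
    case False
    have "(\<Sum>c\<in>Basis. (\<alpha>(b := \<alpha> b - 1)) c) = \<alpha> b - 1 + (\<Sum>c\<in>Basis - {b}. \<alpha> c)"
      using b by (subst sum.remove[of _ b]) (auto intro!: sum.cong)
    moreover have "(\<Sum>c\<in>Basis. \<alpha> c) = \<alpha> b + (\<Sum>c\<in>Basis - {b}. \<alpha> c)"
      using b by (intro sum.remove) auto
    ultimately have "(\<Sum>c\<in>Basis. (\<alpha>(b := \<alpha> b - 1)) c) \<le> k - 1"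
      using step.hyps False by linarith
    then show ?thesis by (rule polys_cmult[OF monomial_in_polys])
  qed
  then have "(\<lambda>x. c * ?h x + g x) \<in> polys (k - 1)"
    by (rule polys_add[OF polys_cmult g(1)])
  then show ?case
  proof (rule bexI[rotated], intro allI)
    fix x
    show "((\<lambda>s. c * monomial \<alpha> (x + s *\<^sub>R b) + f (x + s *\<^sub>R b)) has_vector_derivative
        c * ?h x + g x) (at 0)"
      by (intro has_vector_derivative_add has_vector_derivative_mult_right
          monomial_has_partial_deriv b g)
  qed
qed

lemma
  assumes "b \<in> Basis" and "f \<in> polys k"
  shows polys_partial_deriv: "partial_deriv b f \<in> polys (k - 1)"
    and polys_has_partial_deriv:
      "((\<lambda>s. f (x + s *\<^sub>R b)) has_vector_derivative partial_deriv b f x) (at 0)"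
proof -
  obtain g where g: "g \<in> polys (k - 1)"
    "\<And>x. ((\<lambda>s. f (x + s *\<^sub>R b)) has_vector_derivative g x) (at 0)"
    using polys_has_partial_deriv_in_polys[OF assms] by blast
  then have "partial_deriv b f = g"
    by (auto simp: partial_deriv_def vector_derivative_at)
  with g show "partial_deriv b f \<in> polys (k - 1)"
    "((\<lambda>s. f (x + s *\<^sub>R b)) has_vector_derivative partial_deriv b f x) (at 0)" by auto
qed

lemma partial_deriv_sum:
  assumes "b \<in> Basis" and "\<And>i. i \<in> I \<Longrightarrow> f i \<in> polys k"
  shows "partial_deriv b (\<lambda>x. \<Sum>i\<in>I. c i * f i x) = (\<lambda>x. \<Sum>i\<in>I. c i * partial_deriv b (f i) x)"
proof
  fix x
  have "((\<lambda>s. \<Sum>i\<in>I. c i * f i (x + s *\<^sub>R b)) has_vector_derivative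
      (\<Sum>i\<in>I. c i * partial_deriv b (f i) x)) (at 0)"
    by (intro has_vector_derivative_sum has_vector_derivative_mult_right
        polys_has_partial_deriv[where k = k] assms)
  then show "partial_deriv b (\<lambda>x. \<Sum>i\<in>I. c i * f i x) x = (\<Sum>i\<in>I. c i * partial_deriv b (f i) x)"
    by (simp add: partial_deriv_def[of b "\<lambda>x. \<Sum>i\<in>I. c i * f i x"] vector_derivative_at)
qed

lemma laplacian_sum:
  assumes "\<And>i. i \<in> I \<Longrightarrow> f i \<in> polys k"
  shows "laplacian (\<lambda>x. \<Sum>i\<in>I. c i * f i x) x = (\<Sum>i\<in>I. c i * laplacian (f i) x)"
proof -
  have "laplacian (\<lambda>x. \<Sum>i\<in>I. c i * f i x) x =
      (\<Sum>b\<in>Basis. \<Sum>i\<in>I. c i * partial_deriv b (partial_deriv b (f i)) x)"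
    unfolding laplacian_def
    by (intro sum.cong refl)
      (simp add: partial_deriv_sum[OF _ assms] partial_deriv_sum[OF _ polys_partial_deriv[OF _ assms]])
  then show ?thesis
    by (subst (asm) sum.swap) (simp add: laplacian_def sum_distrib_left)
qed

lemma polys_laplacian:
  assumes "f \<in> polys k"
  shows "laplacian f \<in> polys (k - 2)"
proof -
  have "partial_deriv b (partial_deriv b f) \<in> polys (k - 1 - 1)" if "b \<in> Basis" for b
    using assms that by (intro polys_partial_deriv)
  then have "(\<lambda>x. laplacian f x) \<in> polys (k - 2)"
    unfolding laplacian_def by (intro polys_sum) (simp add: numeral_2_eq_2)
  then show ?thesis by simp
qed

lemma laplacian_const: "laplacian (\<lambda>_. c) = (\<lambda>_. 0)"
  by (auto simp: laplacian_def partial_deriv_def)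

lemma partial_deriv_eq_0_open:
  assumes "open U" and "\<And>x. x \<in> U \<Longrightarrow> f x = 0" and "x \<in> U"
  shows "partial_deriv b f x = 0"
proof -
  let ?V = "(\<lambda>s. x + s *\<^sub>R b) -` U"
  have "open ?V"
    by (intro open_vimage assms continuous_intros)
  then have "((\<lambda>s. f (x + s *\<^sub>R b)) has_vector_derivative 0) (at 0)"
    by (rule has_vector_derivative_transform_within_open[rotated]) (use assms in auto)
  then show ?thesis by (simp add: partial_deriv_def vector_derivative_at)
qed

text \<open>The first partial derivatives vanish on all of \<open>U\<close>, not just at
  \<open>x\<close>, so the previous lemma applies to them again.\<close>

lemma laplacian_eq_0_open:
  assumes "open U" and "\<And>x. x \<in> U \<Longrightarrow> f x = 0" and "x \<in> U"
  shows "laplacian f x = 0"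
  unfolding laplacian_def
  by (intro sum.neutral ballI partial_deriv_eq_0_open[OF assms(1) _ assms(3)]
      partial_deriv_eq_0_open[OF assms(1,2)])


section \<open>Space-time polynomials\<close>

lemma monomial_prod:
  fixes x :: "'a::euclidean_space" and t :: real
  shows "monomial \<alpha> (x, t) = monomial (\<lambda>b. \<alpha> (b, 0)) x * complex_of_real t ^ \<alpha> (0, 1)"
proof -
  have "inj_on (\<lambda>u::'a. (u, 0::real)) Basis" by (auto intro: inj_onI)
  then show ?thesis
    unfolding monomial_def Basis_prod_def
    by (subst prod.union_disjoint) (auto simp: prod.reindex)
qed

lemma sum_Basis_prod_real:
  fixes \<alpha> :: "'a::euclidean_space \<times> real \<Rightarrow> nat"
  shows "(\<Sum>b\<in>Basis. \<alpha> b) = (\<Sum>b\<in>Basis. \<alpha> (b, 0)) + \<alpha> (0, 1)"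
proof -
  have "inj_on (\<lambda>u::'a. (u, 0::real)) Basis" by (auto intro: inj_onI)
  then show ?thesis
    unfolding Basis_prod_def by (subst sum.union_disjoint) (auto simp: sum.reindex)
qed

lemma polys_fst:
  fixes f :: "'a::euclidean_space \<Rightarrow> complex"
  assumes "f \<in> polys k"
  shows "(\<lambda>z::'a \<times> real. f (fst z)) \<in> polys k"
  using assms
proof (induction rule: polys_induct)
  case zero
  show ?case by (rule polys_zero)
next
  case (step c \<alpha> g)
  \<comment> \<open>The basis vectors of the product are \<open>(u, 0)\<close> and
    \<open>(0, 1)\<close>, so testing \<open>s = 0\<close> separates space from time.\<close>
  let ?\<beta> = "\<lambda>(u::'a, s::real). if s = 0 then \<alpha> u else 0"
  have "monomial ?\<beta> \<in> polys k"
    using step.hyps by (intro monomial_in_polys) (simp add: sum_Basis_prod_real)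
  moreover have "monomial ?\<beta> = (\<lambda>z. monomial \<alpha> (fst z))"
    by (auto simp: monomial_prod)
  ultimately show ?case by (auto intro!: polys_add polys_cmult step)
qed

lemma polys_time:
  "(\<lambda>z::'a::euclidean_space \<times> real. complex_of_real (snd z) - c) \<in> polys 1"
proof -
  let ?\<beta> = "\<lambda>(u::'a, s::real). if s = 0 then 0 else (1::nat)"
  have "(\<lambda>z. monomial ?\<beta> z + (- c)) \<in> polys 1"
    by (intro polys_add polys_const monomial_in_polys) (simp add: sum_Basis_prod_real)
  moreover have "monomial ?\<beta> = (\<lambda>z::'a \<times> real. complex_of_real (snd z))"
    by (auto simp: monomial_prod monomial_zero)
  ultimately show ?thesis by simp
qed

text \<open>Centring at \<open>t0\<close> makes \<open>c 0\<close> the initial datum. The zero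
  coefficient at \<open>Suc k\<close> lets the index be shifted under the time derivative without a
  boundary term.\<close>

lemma polys_time_expansion:
  fixes q :: "'a::euclidean_space \<times> real \<Rightarrow> complex"
  assumes "q \<in> polys k"
  obtains c where "\<And>j. c j \<in> polys k" and "c (Suc k) = (\<lambda>_. 0)"
    and "q = (\<lambda>(x, t). \<Sum>j\<le>k. c j x * complex_of_real (t - t0) ^ j)"
proof -
  have "\<exists>c. (\<forall>j. c j \<in> polys k) \<and> c (Suc k) = (\<lambda>_. 0) \<and>
      q = (\<lambda>(x, t). \<Sum>j\<le>k. c j x * complex_of_real (t - t0) ^ j)"
    using assms
  proof (induction rule: polys_induct)
    case zero
    show ?case by (rule exI[of _ "\<lambda>_ _. 0"]) (auto simp: polys_zero)
  next
    case (step d \<alpha> q)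
    then obtain c where c: "\<And>j. c j \<in> polys k" "c (Suc k) = (\<lambda>_. 0)"
      "q = (\<lambda>(x, t). \<Sum>j\<le>k. c j x * complex_of_real (t - t0) ^ j)" by blast
    define n where "n = \<alpha> (0, 1)"
    define M where "M = monomial (\<lambda>b. \<alpha> (b, 0))"
    have nk: "n \<le> k" and M: "M \<in> polys k"
      using step.hyps unfolding n_def M_def
      by (auto simp: sum_Basis_prod_real intro!: monomial_in_polys)
    \<comment> \<open>These are the coefficients of \<open>((t - t0) + t0) ^ n\<close>. They vanish
      for \<open>j > n\<close>, so the sum extends to \<open>k\<close> and the coefficient at
      \<open>Suc k\<close> is zero.\<close>
    let ?e = "\<lambda>j. of_nat (n choose j) * complex_of_real t0 ^ (n - j)"
    have "complex_of_real t ^ n = (\<Sum>j\<le>k. ?e j * complex_of_real (t - t0) ^ j)" for t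
    proof -
      have "complex_of_real t ^ n = (complex_of_real (t - t0) + of_real t0) ^ n" by simp
      also have "\<dots> = (\<Sum>j\<le>n. ?e j * complex_of_real (t - t0) ^ j)"
        unfolding binomial_ring by (simp add: mult_ac)
      also have "\<dots> = (\<Sum>j\<le>k. ?e j * complex_of_real (t - t0) ^ j)"
        using nk by (intro sum.mono_neutral_left) auto
      finally show ?thesis .
    qed
    then have mon: "monomial \<alpha> (x, t) = M x * (\<Sum>j\<le>k. ?e j * complex_of_real (t - t0) ^ j)"
      for x t by (simp add: monomial_prod M_def n_def)
    let ?c = "\<lambda>j x. (d * ?e j) * M x + c j x"
    have "?c j \<in> polys k" for j
      by (intro polys_add polys_cmult c M)
    moreover have "?c (Suc k) = (\<lambda>_. 0)"
      using nk by (simp add: c(2) binomial_eq_0)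
    moreover have "(\<lambda>z. d * monomial \<alpha> z + q z) =
        (\<lambda>(x, t). \<Sum>j\<le>k. ?c j x * complex_of_real (t - t0) ^ j)"
      by (simp add: fun_eq_iff mon c(3) sum_distrib_left sum.distrib ring_distribs mult_ac
          del: of_real_diff)
    ultimately show ?case
      by (intro exI[of _ ?c]) blast
  qed
  then show ?thesis using that by blast
qed

lemma polys_space_section:
  fixes q :: "'a::euclidean_space \<times> real \<Rightarrow> complex"
  assumes "q \<in> polys k"
  shows "(\<lambda>x. q (x, t)) \<in> polys k"
proof -
  obtain c where c: "\<And>j. c j \<in> polys k"
    "c (Suc k) = (\<lambda>_. 0)" "q = (\<lambda>(x, t). \<Sum>j\<le>k. c j x * complex_of_real (t - 0) ^ j)"
    using polys_time_expansion[OF assms, where ?t0.0 = 0] by blast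
  have "(\<lambda>x. \<Sum>j\<le>k. complex_of_real (t - 0) ^ j * c j x) \<in> polys k"
    by (intro polys_sum polys_cmult c)
  then show ?thesis by (simp add: c(3) mult.commute)
qed


section \<open>The Schroedinger equation\<close>

text \<open>The time derivative shifts coefficients down by one and the Laplacian acts on each
  separately. The common bound \<open>k\<close> guarantees that every coefficient is
  differentiable.\<close>

lemma schroedinger_time_expansion:
  fixes c :: "nat \<Rightarrow> 'a::euclidean_space \<Rightarrow> complex"
  assumes c: "\<And>j. c j \<in> polys k" and last: "c (Suc N) = (\<lambda>_. 0)"
  shows "schroedinger (\<lambda>(x, t). \<Sum>j\<le>N. c j x * complex_of_real (t - t0) ^ j) x t =
    (\<Sum>j\<le>N. (\<i> * of_nat (Suc j) * c (Suc j) x + 1 / 2 * laplacian (c j) x) *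
      complex_of_real (t - t0) ^ j)"
proof -
  let ?T = "complex_of_real (t - t0)"
  let ?D = "\<Sum>j\<le>N. c j x * (of_nat j * ?T ^ (j - 1))"
  have "((\<lambda>z. \<Sum>j\<le>N. c j x * (z - of_real t0) ^ j) has_field_derivative ?D) (at (of_real t))"
    by (intro DERIV_sum) (auto intro!: derivative_eq_intros)
  then have "((\<lambda>s. \<Sum>j\<le>N. c j x * (of_real s - of_real t0) ^ j) has_vector_derivative ?D) (at t)"
    by (rule has_vector_derivative_real_field)
  then have dt: "vector_derivative (\<lambda>s. \<Sum>j\<le>N. c j x * complex_of_real (s - t0) ^ j) (at t) = ?D"
    by (simp add: vector_derivative_at)
  \<comment> \<open>The added top term is zero by \<open>last\<close>; after the shift, the bottom
    term drops out through its factor \<open>of_nat 0\<close>.\<close>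
  have "?D = (\<Sum>j\<le>Suc N. c j x * (of_nat j * ?T ^ (j - 1)))"
    by (simp add: last)
  also have "\<dots> = (\<Sum>j\<le>N. of_nat (Suc j) * c (Suc j) x * ?T ^ j)"
    by (subst sum.atMost_Suc_shift) (simp add: mult_ac)
  finally have D: "?D = (\<Sum>j\<le>N. of_nat (Suc j) * c (Suc j) x * ?T ^ j)" .
  have "laplacian (\<lambda>y. \<Sum>j\<le>N. ?T ^ j * c j y) x = (\<Sum>j\<le>N. ?T ^ j * laplacian (c j) x)"
    by (rule laplacian_sum[OF c])
  then show ?thesis
    unfolding schroedinger_def using dt
    by (simp only: prod.case D mult.commute[of "_ ^ _"])
      (simp only: sum_distrib_left sum.distrib ring_distribs mult_ac)
qed

lemma schroedinger_linear:
  fixes q r :: "'a::euclidean_space \<times> real \<Rightarrow> complex"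
  assumes q: "q \<in> polys k" and r: "r \<in> polys k"
  shows "schroedinger (\<lambda>z. a * q z + r z) x t = a * schroedinger q x t + schroedinger r x t"
proof -
  obtain c where c: "\<And>j. c j \<in> polys k" "c (Suc k) = (\<lambda>_. 0)"
    "q = (\<lambda>(x, t). \<Sum>j\<le>k. c j x * complex_of_real (t - 0) ^ j)"
    using polys_time_expansion[OF q, where ?t0.0 = 0] by blast
  obtain d where d: "\<And>j. d j \<in> polys k" "d (Suc k) = (\<lambda>_. 0)"
    "r = (\<lambda>(x, t). \<Sum>j\<le>k. d j x * complex_of_real (t - 0) ^ j)"
    using polys_time_expansion[OF r, where ?t0.0 = 0] by blast
  let ?e = "\<lambda>j x. a * c j x + d j x"
  have eq: "(\<lambda>z. a * q z + r z) = (\<lambda>(x, t). \<Sum>j\<le>k. ?e j x * complex_of_real (t - 0) ^ j)"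
    by (auto simp: c(3) d(3) sum_distrib_left sum.distrib algebra_simps)
  \<comment> \<open>Two-term linearity is read off \<open>laplacian_sum\<close> with the booleans as
    index set.\<close>
  have lap: "laplacian (?e j) x = a * laplacian (c j) x + laplacian (d j) x" for j
    using laplacian_sum[of "{True, False}" "\<lambda>b. if b then c j else d j" k
        "\<lambda>b. if b then a else 1"] c(1) d(1) by simp
  have "schroedinger (\<lambda>z. a * q z + r z) x t =
    (\<Sum>j\<le>k. (\<i> * of_nat (Suc j) * ?e (Suc j) x + 1 / 2 * laplacian (?e j) x) *
      complex_of_real (t - 0) ^ j)"
    unfolding eq using c(2) d(2)
    by (intro schroedinger_time_expansion[of _ k] polys_add polys_cmult c(1) d(1)) auto
  also have "\<dots> = a * schroedinger q x t + schroedinger r x t"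
    unfolding c(3) d(3) schroedinger_time_expansion[of c, OF c(1,2)]
      schroedinger_time_expansion[of d, OF d(1,2)] lap
    by (simp only: sum_distrib_left sum.distrib[symmetric]) (intro sum.cong refl, algebra)
  finally show ?thesis .
qed

text \<open>
  Comparing powers of \<open>t - t0\<close> in the equation expresses the coefficient of \<open>(t - t0) ^ (j + 1)\<close>
  through the Laplacian of the coefficient of \<open>(t - t0) ^ j\<close>, so vanishing initial data kill
  every coefficient, first on the interior of \<open>S\<close> and then on \<open>S\<close> by continuity.
\<close>
lemma schroedinger_zero_initial_data:
  fixes q :: "'a::euclidean_space \<times> real \<Rightarrow> complex"
  assumes q: "q \<in> polys k" and eq: "\<And>x t. x \<in> S \<Longrightarrow> t \<in> T \<Longrightarrow> schroedinger q x t = 0"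
    and S: "S \<subseteq> closure (interior S)" and T: "infinite T"
    and init: "\<And>x. x \<in> S \<Longrightarrow> q (x, t0) = 0" and "x \<in> S"
  shows "q (x, t) = 0"
proof -
  obtain c where c: "\<And>j. c j \<in> polys k" "c (Suc k) = (\<lambda>_. 0)"
    and q_eq: "q = (\<lambda>(x, t). \<Sum>j\<le>k. c j x * complex_of_real (t - t0) ^ j)"
    using polys_time_expansion[OF q, where ?t0.0 = t0] by blast
  have rec: "\<i> * of_nat (Suc j) * c (Suc j) x + 1 / 2 * laplacian (c j) x = 0"
    if "x \<in> S" "j \<le> k" for x j
  \<comment> \<open>For fixed \<open>x\<close> the equation is a polynomial identity in
    \<open>z = t - t0\<close>. A nonzero coefficient would leave finitely many roots, yet every
    \<open>t\<close> in the infinite set \<open>T\<close> gives one.\<close>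
  proof (rule ccontr)
    let ?a = "\<lambda>j. \<i> * of_nat (Suc j) * c (Suc j) x + 1 / 2 * laplacian (c j) x"
    assume "?a j \<noteq> 0"
    then have "finite {z. (\<Sum>j\<le>k. ?a j * z ^ j) = 0}"
      using that polyfun_finite_roots[of ?a k] by blast
    moreover have "(\<lambda>t. complex_of_real (t - t0)) ` T \<subseteq> {z. (\<Sum>j\<le>k. ?a j * z ^ j) = 0}"
      using eq[OF \<open>x \<in> S\<close>] unfolding q_eq schroedinger_time_expansion[of c, OF c] by auto
    ultimately have "finite ((\<lambda>t. complex_of_real (t - t0)) ` T)"
      by (rule rev_finite_subset)
    then show False
      using T by (auto dest!: finite_imageD intro!: inj_onI)
  qed
  have c_0: "c 0 x = 0" if "x \<in> S" for x
    using init[OF that] by (simp add: q_eq power_0_left if_distrib cong: if_cong)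
  have int: "\<forall>x\<in>interior S. c j x = 0" if "j \<le> k" for j
    using that
  proof (induction j)
    case 0
    then show ?case using c_0 interior_subset by blast
  next
    case (Suc j)
    show ?case
    proof
      fix x assume x: "x \<in> interior S"
      \<comment> \<open>Vanishing at \<open>x\<close> alone would say nothing about the Laplacian;
        the induction hypothesis holds on an open neighbourhood of \<open>x\<close>.\<close>
      have "laplacian (c j) x = 0"
        using Suc x by (intro laplacian_eq_0_open[of "interior S"]) auto
      moreover have "x \<in> S" using x interior_subset by blast
      ultimately have "\<i> * of_nat (Suc j) * c (Suc j) x = 0"
        using rec[of x j] Suc.prems by simp
      then show "c (Suc j) x = 0" by (simp del: of_nat_Suc)
    qed
  qed
  have "c j x = 0" if "j \<le> k" for j
  proof (rule continuous_constant_on_closure[of "interior S"])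
    show "continuous_on (closure (interior S)) (c j)"
      using c(1) by (rule polys_continuous)
  qed (use int[OF that] S \<open>x \<in> S\<close> in blast)+
  then show ?thesis by (simp add: q_eq)
qed

text \<open>
  The solution is the exponential series of \<open>\<i> (t - t0) \<Delta> / 2\<close> applied to \<open>f\<close>. It terminates, and
  since each power of \<open>t\<close> is paid for by two degrees in \<open>x\<close>, the total degree does not grow.
\<close>
lemma schroedinger_polynomial_solution:
  fixes f :: "'a::euclidean_space \<Rightarrow> complex"
  assumes f: "f \<in> polys (2 * p)"
  obtains q where "q \<in> polys (2 * p)" and "\<And>x t. schroedinger q x t = 0"
    and "\<And>x. q (x, t0) = f x"
proof -
  \<comment> \<open>Solving the recursion gives
    \<open>c (Suc j) = \<i> / (2 * (j + 1)) * laplacian (c j)\<close>, starting from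
    \<open>c 0 = f\<close>.\<close>
  define c where "c j x = (\<i> / 2) ^ j / fact j * (laplacian ^^ j) f x" for j x
  define q where "q = (\<lambda>(x, t). \<Sum>j\<le>p. c j x * complex_of_real (t - t0) ^ j)"
  have L: "(laplacian ^^ j) f \<in> polys (2 * p - 2 * j)" for j
  proof (induction j)
    case (Suc j)
    show ?case using polys_laplacian[OF Suc] by (simp add: numeral_2_eq_2)
  qed (use f in simp)
  have c: "c j \<in> polys (2 * p - 2 * j)" for j
    unfolding c_def by (intro polys_cmult L)
  \<comment> \<open>The degree bound is \<open>0\<close> at \<open>j = p\<close>, so one further
    Laplacian gives zero and the series stops at \<open>p\<close>.\<close>
  obtain a where "(laplacian ^^ p) f = (\<lambda>_. a)"
    using L[of p] by (auto elim: polys_0_constant)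
  then have "laplacian ((laplacian ^^ p) f) = (\<lambda>_. 0)"
    by (simp add: laplacian_const)
  then have last: "c (Suc p) = (\<lambda>_. 0)"
    by (simp add: fun_eq_iff c_def)
  \<comment> \<open>Homogeneity of the Laplacian is \<open>laplacian_sum\<close> over a
    singleton.\<close>
  have "laplacian (c j) x = (\<i> / 2) ^ j / fact j * (laplacian ^^ Suc j) f x" for j x
    using laplacian_sum[of "{()}" "\<lambda>_. (laplacian ^^ j) f" _ "\<lambda>_. (\<i> / 2) ^ j / fact j"] L[of j]
    by (simp add: c_def[abs_def])
  then have rec: "\<i> * of_nat (Suc j) * c (Suc j) x + 1 / 2 * laplacian (c j) x = 0" for j x
    by (simp add: c_def field_simps del: of_nat_Suc)
  have "schroedinger q x t = 0" for x t
    unfolding q_def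
      schroedinger_time_expansion[of c, OF polys_mono[OF diff_le_self c] last] rec by simp
  moreover have "q \<in> polys (2 * p)"
  proof -
    \<comment> \<open>The degree in space is at most \<open>2 * p - 2 * j\<close> and in time
      \<open>j\<close>, altogether \<open>2 * p - j\<close>.\<close>
    have "(\<lambda>z. c j (fst z) * (complex_of_real (snd z) - of_real t0) ^ j) \<in> polys (2 * p)"
      if "j \<le> p" for j
      using polys_mult[OF polys_fst[OF c[of j]] polys_power[OF polys_time, of "of_real t0" j]]
      by (rule polys_mono[rotated]) (use that in simp)
    then have "(\<lambda>z. \<Sum>j\<le>p. c j (fst z) * (complex_of_real (snd z) - of_real t0) ^ j) \<in> polys (2 * p)"
      by (intro polys_sum) auto
    then show ?thesis by (simp add: q_def case_prod_unfold)
  qed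
  moreover have "q (x, t0) = f x" for x
  proof -
    have "q (x, t0) = c 0 x"
      by (simp add: q_def power_0_left if_distrib cong: if_cong)
    then show ?thesis by (simp add: c_def)
  qed
  ultimately show ?thesis using that by blast
qed

section \<open>Linear structure of the Trefftz space and transport of bases\<close>

lemma subspace_trefftz_space: "cfun.subspace (trefftz_space k K)"
proof -
  let ?Q = "{q \<in> polys k. \<forall>(x, t) \<in> K. schroedinger q x t = 0}"
  \<comment> \<open>The case \<open>a = 1\<close> gives sums, and the case where \<open>r\<close> is
    zero gives multiples.\<close>
  have comb: "on_set K (\<lambda>z. a * q z + r z) \<in> trefftz_space k K" if "q \<in> ?Q" "r \<in> ?Q" for a q r
  proof -
    have "schroedinger (\<lambda>z. a * q z + r z) x t = 0" if "(x, t) \<in> K" for x t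
      using schroedinger_linear[of q k r a x t] \<open>q \<in> ?Q\<close> \<open>r \<in> ?Q\<close> that by fastforce
    then show ?thesis
      using that unfolding trefftz_space_def by (auto intro!: imageI polys_add polys_cmult)
  qed
  have zero: "(\<lambda>_. 0) \<in> ?Q"
    by (simp add: polys_zero schroedinger_def laplacian_const)
  show ?thesis
  proof (rule cfun.subspaceI)
    have "on_set K (\<lambda>_. 0) \<in> trefftz_space k K"
      unfolding trefftz_space_def using zero by (rule imageI)
    moreover have "on_set K (\<lambda>_. 0) = 0" by (auto simp: on_set_def)
    ultimately show "0 \<in> trefftz_space k K" by simp
  next
    fix f g assume "f \<in> trefftz_space k K" "g \<in> trefftz_space k K"
    then obtain q r where qr: "q \<in> ?Q" "r \<in> ?Q" "f = on_set K q" "g = on_set K r"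
      unfolding trefftz_space_def by blast
    then have "f + g = on_set K (\<lambda>z. 1 * q z + r z)"
      by (auto simp: on_set_def)
    then show "f + g \<in> trefftz_space k K" using comb[OF qr(1,2), of 1] by simp
  next
    fix a f assume "f \<in> trefftz_space k K"
    then obtain q where q: "q \<in> ?Q" "f = on_set K q"
      unfolding trefftz_space_def by blast
    then have "fscale a f = on_set K (\<lambda>z. a * q z + 0)"
      by (auto simp: on_set_def fscale_def)
    then show "fscale a f \<in> trefftz_space k K" using comb[OF q(1) zero] by simp
  qed
qed

text \<open>\<open>R\<close> is linear on all functions but injective only on \<open>V\<close>.
  Spanning follows by lifting an element of the span of \<open>B\<close> into the span of the
  preimage; independence follows by pushing a relation forward to \<open>B\<close>.\<close>

lemma basis_of_preimage:
  assumes lin: "Vector_Spaces.linear fscale fscale R" and V: "cfun.subspace V"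
    and bij: "bij_betw R V W" and B: "basis_of B W"
  shows "basis_of {v \<in> V. R v \<in> B} V"
proof -
  interpret R: Vector_Spaces.linear fscale fscale R by (rule lin)
  let ?B = "{v \<in> V. R v \<in> B}"
  have BW: "B \<subseteq> W" "cfun.independent B" "cfun.span B = W"
    using B by (auto simp: basis_of_def)
  have inj: "inj_on R V" and im: "R ` V = W"
    using bij by (auto simp: bij_betw_def)
  have "B \<subseteq> R ` V" using BW(1) im by simp
  then have imB: "R ` ?B = B" by blast
  have span_le: "cfun.span ?B \<subseteq> V"
    using V by (intro cfun.span_minimal) auto
  have "v \<in> cfun.span ?B" if "v \<in> V" for v
  proof -
    have "R v \<in> cfun.span (R ` ?B)" using that im BW imB by auto
    then obtain u where u: "u \<in> cfun.span ?B" "R v = R u"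
      unfolding R.span_image by blast
    then have "v = u" using inj span_le that by (auto dest: inj_onD)
    with u show ?thesis by simp
  qed
  moreover have "cfun.independent ?B"
    unfolding cfun.independent_explicit_module
  proof (intro allI impI)
    fix t u v assume t: "finite t" "t \<subseteq> ?B" "(\<Sum>v\<in>t. fscale (u v) v) = 0" "v \<in> t"
    have injt: "inj_on R t" using t inj by (auto intro: inj_on_subset)
    let ?u = "\<lambda>w. u (the_inv_into t R w)"
    have "(\<Sum>w\<in>R ` t. fscale (?u w) w) = (\<Sum>v\<in>t. fscale (u v) (R v))"
      using injt by (simp add: sum.reindex the_inv_into_f_f)
    also have "\<dots> = R (\<Sum>v\<in>t. fscale (u v) v)" by (simp add: R.sum R.scale)
    also have "\<dots> = 0" using t R.zero by simp
    finally have "?u (R v) = 0"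
      using t by (intro cfun.independentD[OF BW(2), of "R ` t"]) auto
    then show "u v = 0" using injt t by (simp add: the_inv_into_f_f)
  qed
  ultimately show ?thesis
    using span_le unfolding basis_of_def by blast
qed

text \<open>Uniqueness for zero initial data gives injectivity, the terminating exponential series
  gives surjectivity, and time sections of polynomials stay within the degree bound.\<close>

lemma bij_betw_trefftz_initial_data:
  fixes S :: "'a::euclidean_space set"
  assumes S: "S \<subseteq> closure (interior S)" and T: "infinite T" and "t0 \<in> T"
  shows "bij_betw (\<lambda>b. on_set S (\<lambda>x. b (x, t0))) (trefftz_space (2 * p) (S \<times> T))
    (poly_space (2 * p) S)"
proof -
  let ?K = "S \<times> T" and ?R = "\<lambda>b. on_set S (\<lambda>x. b (x, t0))"
  let ?V = "trefftz_space (2 * p) ?K"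
  \<comment> \<open>Because \<open>t0 \<in> T\<close>, the extension by zero leaves the slice at
    \<open>t0\<close> over \<open>S\<close> intact.\<close>
  have R: "?R (on_set ?K q) = on_set S (\<lambda>x. q (x, t0))" for q
    using \<open>t0 \<in> T\<close> by (auto simp: on_set_def)
  have "inj_on ?R ?V"
  proof (rule inj_onI)
    fix f g assume fg: "f \<in> ?V" "g \<in> ?V" "?R f = ?R g"
    \<comment> \<open>The subspace property supplies one solution polynomial representing the
      difference, to which uniqueness applies.\<close>
    then have "f - g \<in> ?V" by (intro cfun.subspace_diff subspace_trefftz_space)
    then obtain q where q: "q \<in> polys (2 * p)" "\<And>x t. x \<in> S \<Longrightarrow> t \<in> T \<Longrightarrow> schroedinger q x t = 0"
      and eq: "f - g = on_set ?K q" unfolding trefftz_space_def by auto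
    have "q (x, t0) = 0" if "x \<in> S" for x
      using fun_cong[OF fg(3), of x] fun_cong[OF eq, of "(x, t0)"] that \<open>t0 \<in> T\<close>
      by (simp add: on_set_def)
    then have "q (x, t) = 0" if "x \<in> S" for x t
      using schroedinger_zero_initial_data[OF q S T] that by blast
    then have "f - g = 0" unfolding eq by (auto simp: on_set_def)
    then show "f = g" by simp
  qed
  moreover have "?R ` ?V \<subseteq> poly_space (2 * p) S"
  proof (rule image_subsetI)
    fix b assume "b \<in> ?V"
    then obtain q where "q \<in> polys (2 * p)" "b = on_set ?K q"
      unfolding trefftz_space_def by blast
    then show "?R b \<in> poly_space (2 * p) S"
      unfolding poly_space_def by (simp add: R polys_space_section)
  qed
  moreover have "poly_space (2 * p) S \<subseteq> ?R ` ?V"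
  proof
    fix g assume "g \<in> poly_space (2 * p) S"
    then obtain f where f: "f \<in> polys (2 * p)" "g = on_set S f"
      unfolding poly_space_def by blast
    obtain q where q: "q \<in> polys (2 * p)" "\<And>x t. schroedinger q x t = 0" "\<And>x. q (x, t0) = f x"
      using schroedinger_polynomial_solution[OF f(1)] by metis
    then have "on_set ?K q \<in> ?V" and "g = ?R (on_set ?K q)"
      unfolding R f(2) trefftz_space_def by auto
    then show "g \<in> ?R ` ?V" by blast
  qed
  ultimately show ?thesis by (auto simp: bij_betw_def)
qed

theorem proposition3p1:
  fixes p :: nat
    and Kx :: "(real ^ 'd) set" and Kt :: "real set" and tK :: real
    and m :: "nat \<Rightarrow> real ^ 'd \<Rightarrow> complex"
  defines "r \<equiv> (2 * p + CARD('d)) choose CARD('d)"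
    and "K \<equiv> Kx \<times> Kt"
  assumes "p \<ge> 1"
    and "polytope Kx" and "aff_dim Kx = int CARD('d)"
    and "is_interval Kt" and "bounded Kt" and "interior Kt \<noteq> {}"
    and "tK \<in> Kt"
    and "inj_on m {1..r}" and "basis_of (m ` {1..r}) (poly_space (2 * p) Kx)"
  shows "(\<forall>J \<in> {1..r}. \<exists>!b. b \<in> trefftz_space (2 * p) K \<and> (\<forall>x \<in> Kx. b (x, tK) = m J x)) \<and>
    basis_of {b \<in> trefftz_space (2 * p) K. \<exists>J \<in> {1..r}. \<forall>x \<in> Kx. b (x, tK) = m J x}
      (trefftz_space (2 * p) K)"
proof -
  let ?V = "trefftz_space (2 * p) K" and ?W = "poly_space (2 * p) Kx"
  let ?R = "\<lambda>b. on_set Kx (\<lambda>x. b (x, tK))"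
  have convex: "convex Kx" using \<open>polytope Kx\<close> by (rule polytope_imp_convex)
  have "Kx \<noteq> {}" using \<open>aff_dim Kx = int CARD('d)\<close> by auto
  \<comment> \<open>Full affine dimension identifies the relative interior, nonempty for a nonempty
    convex set, with the interior.\<close>
  moreover have "rel_interior Kx = interior Kx"
    using \<open>aff_dim Kx = int CARD('d)\<close> by (simp add: interior_rel_interior_gen)
  ultimately have "interior Kx \<noteq> {}" using rel_interior_eq_empty[OF convex] by simp
  then have Kx: "Kx \<subseteq> closure (interior Kx)"
    using convex_closure_interior[OF convex] closure_subset by blast
  \<comment> \<open>A nonempty finite set of reals is not open, so the interior of \<open>Kt\<close>
    is infinite.\<close>
  have Kt: "infinite Kt"
    using \<open>interior Kt \<noteq> {}\<close> finite_imp_not_open[of "interior Kt"] finite_subset[OF interior_subset]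
    by blast
  have bij: "bij_betw ?R ?V ?W"
    unfolding K_def using Kx Kt \<open>tK \<in> Kt\<close> by (rule bij_betw_trefftz_initial_data)
  have lin: "Vector_Spaces.linear fscale fscale ?R"
    by unfold_locales (auto simp: on_set_def fscale_def)
  have mW: "m J \<in> ?W" if "J \<in> {1..r}" for J
    using assms(11) that by (auto simp: basis_of_def)
  \<comment> \<open>Both \<open>?R b\<close> and \<open>m J\<close> vanish off \<open>Kx\<close>, so
    agreement on \<open>Kx\<close> is equality of functions. This turns the initial condition into a
    statement about preimages under \<open>?R\<close>.\<close>
  have init: "(\<forall>x \<in> Kx. b (x, tK) = m J x) \<longleftrightarrow> ?R b = m J" if "J \<in> {1..r}" for b J
  proof -
    have "m J x = 0" if "x \<notin> Kx" for x
      using mW[OF \<open>J \<in> {1..r}\<close>] that by (auto simp: poly_space_def on_set_def)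
    then show ?thesis by (auto simp: on_set_def fun_eq_iff)
  qed
  have "\<exists>!b. b \<in> ?V \<and> ?R b = m J" if J: "J \<in> {1..r}" for J
  proof -
    obtain b where "b \<in> ?V" "m J = ?R b"
      using bij_betw_imp_surj_on[OF bij] mW[OF J] by blast
    then show ?thesis
      using inj_onD[OF bij_betw_imp_inj_on[OF bij]] by (intro ex1I[of _ b]) simp_all
  qed
  moreover have "{b \<in> ?V. \<exists>J \<in> {1..r}. \<forall>x \<in> Kx. b (x, tK) = m J x} = {b \<in> ?V. ?R b \<in> m ` {1..r}}"
    using init by auto
  moreover have "basis_of {b \<in> ?V. ?R b \<in> m ` {1..r}} ?V"
    using lin subspace_trefftz_space bij assms(11) by (rule basis_of_preimage)
  ultimately show ?thesis by (simp only: init ball_triv simp_thms cong: ball_cong)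
qed

end
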